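(* For every $n\ge 1$, $G_n(\mathsf{x};1,0,1,0)=\sum_{\mu\vdash n}c_\mu\,p_\mu/z_\mu$, where for each partition $\mu$ of $n$ $$c_\mu=\frac{1}{2^{\ell(\mu)}}\sum_{m=1}^{n+1}m^{\ell(\mu)-1}\binom{n}{m-1}.$$
   Context: A (plane binary) tree is a rooted tree in which every node has at most one left child and at most one right child (it may have only one of the two), and no other children. A labeled tree is a tree whose nodes are labeled with positive integers, repetitions allowed; $\mathcal{T}^{\ell}_n$ is the set of labeled trees on $n$ nodes. Write $v^\ell$ for the label of $v$. If $v$ is the left child of $w$, the edge is a left ascent if $v^\ell\le w^\ell$ and a left descent otherwise. If $w$ is the right child of $v$, the edge is a right ascent if $v^\ell\le w^\ell$ and a right descent otherwise. $\mathrm{lasc},\mathrm{ldes},\mathrm{rasc},\mathrm{rdes}$ count these edges. With $\mathsf{x}^T=\prod_{v\in T}x_{v^\ell}$, $$G_n(\mathsf{x};\bar\lambda,\lambda,\bar\rho,\rho)=\sum_{T\in\mathcal{T}^\ell_n}\bar\lambda^{\mathrm{lasc}(T)}\lambda^{\mathrm{ldes}(T)}\bar\rho^{\,\mathrm{rasc}(T)}\rho^{\,\mathrm{rdes}(T)}\,\mathsf{x}^T,$$ so $G_n(\mathsf{x};1,0,1,0)$ is the sum of $\mathsf{x}^T$ over labeled trees on $n$ nodes with no left descents and no right descents. $p_\mu$ is the power sum symmetric function, $\ell(\mu)$ is the number of parts of $\mu$, and $z_\mu=\prod_{i\ge1}i^{m_i}m_i!$ where $m_i$ is the number of parts of $\mu$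 equal to $i$. *)

theory Defs
  imports Complex_Main "HOL-Library.Multiset" "HOL-Library.Tree" "HOL-Library.Tree_Multiset"
begin

section \<open>Formal power series in arbitrarily many variables\<close>

text \<open>
  A monomial in the variables \<open>(x\<^sub>v)\<close> is a finite multiset of indices: the multiset \<open>M\<close>
  stands for the product of all \<open>x\<^sub>v\<close> with \<open>v \<in># M\<close>, taken with multiplicity.
  A formal power series assigns to each monomial its coefficient.
\<close>

typedef ('v, 'a) mps = "UNIV :: ('v multiset \<Rightarrow> 'a) set"
  morphisms mps_coeff Abs_mps
  by simp

lemma mps_coeff_Abs [simp]: "mps_coeff (Abs_mps f) = f"
  by (simp add: Abs_mps_inverse)

lemma mps_eqI: "(\<And>M. mps_coeff f M = mps_coeff g M) \<Longrightarrow> f = g"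
  by (simp add: mps_coeff_inject [symmetric] fun_eq_iff)

lemma finite_mset_splits: "finite {(A, B). A + B = (M :: 'v multiset)}"
proof (induction M)
  case empty
  have "{(A, B). A + B = ({#} :: 'v multiset)} = {({#}, {#})}" by auto
  then show ?case by simp
next
  case (add x M)
  let ?S = "{(A, B). A + B = M}"
  have "{(A, B). A + B = add_mset x M}
      \<subseteq> (\<lambda>(A, B). (add_mset x A, B)) ` ?S \<union> (\<lambda>(A, B). (A, add_mset x B)) ` ?S"
  proof clarify
    fix A B
    assume eq: "A + B = add_mset x M"
      and nin: "(A, B) \<notin> (\<lambda>(A, B). (A, add_mset x B)) ` ?S"
    from eq have "x \<in># A + B" by simp
    then consider A' where "A = add_mset x A'" | B' where "B = add_mset x B'"
      by (auto dest: mset_add)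
    then show "(A, B) \<in> (\<lambda>(A, B). (add_mset x A, B)) ` ?S"
    proof cases
      case 1
      with eq have "(A', B) \<in> ?S" by simp
      with 1 show ?thesis by force
    next
      case 2
      with eq have "(A, B') \<in> ?S" by simp
      with 2 nin show ?thesis by force
    qed
  qed
  with add show ?case by (meson finite_UnI finite_imageI finite_subset)
qed

instantiation mps :: (type, comm_ring_1) comm_ring_1
begin

definition zero_mps :: "('a, 'b) mps" where
  "0 = Abs_mps (\<lambda>_. 0)"

definition one_mps :: "('a, 'b) mps" where
  "1 = Abs_mps (\<lambda>M. if M = {#} then 1 else 0)"

definition plus_mps :: "('a, 'b) mps \<Rightarrow> ('a, 'b) mps \<Rightarrow> ('a, 'b) mps" where
  "f + g = Abs_mps (\<lambda>M. mps_coeff f M + mps_coeff g M)"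

definition uminus_mps :: "('a, 'b) mps \<Rightarrow> ('a, 'b) mps" where
  "- f = Abs_mps (\<lambda>M. - mps_coeff f M)"

definition minus_mps :: "('a, 'b) mps \<Rightarrow> ('a, 'b) mps \<Rightarrow> ('a, 'b) mps" where
  "f - g = Abs_mps (\<lambda>M. mps_coeff f M - mps_coeff g M)"

definition times_mps :: "('a, 'b) mps \<Rightarrow> ('a, 'b) mps \<Rightarrow> ('a, 'b) mps" where
  "f * g = Abs_mps (\<lambda>M. \<Sum>(A, B)\<in>{(A, B). A + B = M}. mps_coeff f A * mps_coeff g B)"

instance
proof
  fix f g h :: "('a, 'b) mps"
  show "f + g + h = f + (g + h)" "f + g = g + f" "0 + f = f" "- f + f = 0" "f - g = f + - g"
    by (simp_all add: plus_mps_def zero_mps_def uminus_mps_def minus_mps_def mps_coeff_inverse ac_simps)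
  show "(0 :: ('a, 'b) mps) \<noteq> 1"
    by (simp add: one_mps_def zero_mps_def Abs_mps_inject fun_eq_iff)
  show "f * g = g * f"
  proof (rule mps_eqI)
    fix M
    show "mps_coeff (f * g) M = mps_coeff (g * f) M"
      by (simp add: times_mps_def,
          rule sum.reindex_bij_witness[where i = prod.swap and j = prod.swap])
        (auto simp: ac_simps)
  qed
  show "(f + g) * h = f * h + g * h"
    by (rule mps_eqI)
      (simp add: times_mps_def plus_mps_def case_prod_unfold distrib_right sum.distrib)
  show "1 * f = f"
  proof (rule mps_eqI)
    fix M
    have "(\<Sum>(A, B)\<in>{(A, B). A + B = M}. (if A = {#} then 1 else 0) * mps_coeff f B)
        = (\<Sum>(A, B)\<in>{({#} :: 'a multiset, M)}. mps_coeff f B)"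
    proof (rule sum.mono_neutral_cong_right)
      show "finite {(A, B). A + B = M}" by (rule finite_mset_splits)
    qed (auto split: if_splits)
    then show "mps_coeff (1 * f) M = mps_coeff f M"
      by (simp add: times_mps_def one_mps_def)
  qed
  show "f * g * h = f * (g * h)"
  proof (rule mps_eqI)
    fix M
    have "mps_coeff (f * g * h) M
        = (\<Sum>p\<in>{(A, B). A + B = M}. \<Sum>q\<in>{(A, B). A + B = fst p}.
            mps_coeff f (fst q) * mps_coeff g (snd q) * mps_coeff h (snd p))"
      by (simp add: times_mps_def case_prod_unfold sum_distrib_right)
    also have "\<dots> = (\<Sum>(p, q)\<in>(SIGMA p:{(A, B). A + B = M}. {(A, B). A + B = fst p}).
            mps_coeff f (fst q) * mps_coeff g (snd q) * mps_coeff h (snd p))"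
      by (rule sum.Sigma) (auto simp: finite_mset_splits)
    also have "\<dots> = (\<Sum>(p, q)\<in>(SIGMA p:{(A, B). A + B = M}. {(A, B). A + B = snd p}).
            mps_coeff f (fst p) * (mps_coeff g (fst q) * mps_coeff h (snd q)))"
      by (rule sum.reindex_bij_witness[where
            i = "\<lambda>((A, D), (B, C)). ((A + B, C), (A, B))" and
            j = "\<lambda>((D, C), (A, B)). ((A, B + C), (B, C))"])
        (auto simp: ac_simps)
    also have "\<dots> = (\<Sum>p\<in>{(A, B). A + B = M}. \<Sum>q\<in>{(A, B). A + B = snd p}.
            mps_coeff f (fst p) * (mps_coeff g (fst q) * mps_coeff h (snd q)))"
      by (rule sum.Sigma [symmetric]) (auto simp: finite_mset_splits)
    also have "\<dots> = mps_coeff (f * (g * h)) M"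
      by (simp add: times_mps_def case_prod_unfold sum_distrib_left)
    finally show "mps_coeff (f * g * h) M = mps_coeff (f * (g * h)) M" .
  qed
qed

end

definition mps_const :: "'a \<Rightarrow> ('v, 'a :: comm_ring_1) mps" where
  "mps_const c = Abs_mps (\<lambda>M. if M = {#} then c else 0)"


section \<open>Labeled plane binary trees\<close>

text \<open>
  In \<^typ>\<open>nat tree\<close> the constructor \<^const>\<open>Leaf\<close> is the empty tree, that is, an absent child;
  the nodes of the plane binary tree are exactly the \<^const>\<open>Node\<close>s, counted by \<^const>\<open>size\<close>.
\<close>

definition labeled_trees :: "nat \<Rightarrow> nat tree set" where
  "labeled_trees n = {T. size T = n \<and> (\<forall>a \<in> set_tree T. 1 \<le> a)}"

text \<open>
  Edges are recorded as pairs (parent label, child label), with multiplicity.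
\<close>

fun root_edge :: "nat \<Rightarrow> nat tree \<Rightarrow> (nat \<times> nat) multiset" where
  "root_edge a \<langle>\<rangle> = {#}"
| "root_edge a \<langle>l, b, r\<rangle> = {#(a, b)#}"

fun left_edges :: "nat tree \<Rightarrow> (nat \<times> nat) multiset" where
  "left_edges \<langle>\<rangle> = {#}"
| "left_edges \<langle>l, a, r\<rangle> = root_edge a l + left_edges l + left_edges r"

fun right_edges :: "nat tree \<Rightarrow> (nat \<times> nat) multiset" where
  "right_edges \<langle>\<rangle> = {#}"
| "right_edges \<langle>l, a, r\<rangle> = root_edge a r + right_edges l + right_edges r"

definition lasc :: "nat tree \<Rightarrow> nat" where
  "lasc T = size {#(parent, child) \<in># left_edges T. child \<le> parent#}"

definition ldes :: "nat tree \<Rightarrow> nat" where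
  "ldes T = size {#(parent, child) \<in># left_edges T. \<not> child \<le> parent#}"

definition rasc :: "nat tree \<Rightarrow> nat" where
  "rasc T = size {#(parent, child) \<in># right_edges T. parent \<le> child#}"

definition rdes :: "nat tree \<Rightarrow> nat" where
  "rdes T = size {#(parent, child) \<in># right_edges T. \<not> parent \<le> child#}"

text \<open>
  The sum over the (infinite) set \<^term>\<open>labeled_trees n\<close> is a formal one and is taken
  coefficientwise. The monomial of a tree \<open>T\<close> is \<^term>\<open>mset_tree T\<close>, and each monomial is that
  of finitely many trees only, as shown by \<open>finite_trees_mset\<close> below.
\<close>

definition tree_gf :: "nat \<Rightarrow> 'a \<Rightarrow> 'a \<Rightarrow> 'a \<Rightarrow> 'a \<Rightarrow> (nat, 'a :: comm_ring_1) mps" where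
  "tree_gf n la ld ra rd =
     Abs_mps (\<lambda>M. \<Sum>T | T \<in> labeled_trees n \<and> mset_tree T = M.
                la ^ lasc T * ld ^ ldes T * ra ^ rasc T * rd ^ rdes T)"

lemma finite_trees_size:
  assumes "finite S"
  shows "finite {t. set_tree t \<subseteq> S \<and> size t \<le> n}"
proof (induction n)
  case 0
  have "{t. set_tree t \<subseteq> S \<and> size t \<le> 0} = {\<langle>\<rangle>}" by auto
  then show ?case by simp
next
  case (Suc n)
  let ?F = "{t. set_tree t \<subseteq> S \<and> size t \<le> n}"
  have "t \<in> insert \<langle>\<rangle> ((\<lambda>(l, a, r). \<langle>l, a, r\<rangle>) ` (?F \<times> S \<times> ?F))"
    if "set_tree t \<subseteq> S" "size t \<le> Suc n" for t
    using that by (cases t) (auto simp: image_iff)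
  then have "{t. set_tree t \<subseteq> S \<and> size t \<le> Suc n}
      \<subseteq> insert \<langle>\<rangle> ((\<lambda>(l, a, r). \<langle>l, a, r\<rangle>) ` (?F \<times> S \<times> ?F))"
    by blast
  moreover have "finite (insert \<langle>\<rangle> ((\<lambda>(l, a, r). \<langle>l, a, r\<rangle>) ` (?F \<times> S \<times> ?F)))"
    using Suc assms by blast
  ultimately show ?case by (rule finite_subset)
qed

lemma finite_trees_mset: "finite {T. T \<in> labeled_trees n \<and> mset_tree T = M}"
  by (rule finite_subset[OF _ finite_trees_size[of "set_mset M" n]])
    (auto simp: labeled_trees_def)


section \<open>Partitions and power sums\<close>

definition partitions :: "nat \<Rightarrow> nat multiset set" where
  "partitions n = {\<mu>. 0 \<notin># \<mu> \<and> sum_mset \<mu> = n}"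

lemma finite_partitions: "finite (partitions n)"
proof (rule finite_subset)
  have size_le: "size \<mu> \<le> sum_mset \<mu>" if "0 \<notin># \<mu>" for \<mu> :: "nat multiset"
    using that by (induction \<mu>) auto
  have set_le: "set_mset \<mu> \<subseteq> {..sum_mset \<mu>}" for \<mu> :: "nat multiset"
    by (auto dest: sum_mset.remove)
  show "partitions n \<subseteq> mset ` {xs. set xs \<subseteq> {..n} \<and> length xs \<le> n}"
  proof (intro subsetI)
    fix \<mu> assume "\<mu> \<in> partitions n"
    moreover obtain xs where "\<mu> = mset xs" using ex_mset by metis
    ultimately show "\<mu> \<in> mset ` {xs. set xs \<subseteq> {..n} \<and> length xs \<le> n}"
      using size_le[of \<mu>] set_le[of \<mu>] by (simp add: partitions_def)
  qed
  show "finite (mset ` {xs. set xs \<subseteq> {..n} \<and> length xs \<le> n})"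
    by (simp add: finite_lists_length_le)
qed

text \<open>
  The factors of \<open>z\<^sub>\<mu>\<close> with multiplicity zero are equal to 1 and omitted.
\<close>

definition z_part :: "nat multiset \<Rightarrow> nat" where
  "z_part \<mu> = (\<Prod>i\<in>set_mset \<mu>. i ^ count \<mu> i * fact (count \<mu> i))"

text \<open>
  The series \<open>x\<^sub>1\<^sup>k + x\<^sub>2\<^sup>k + \<dots>\<close>; meaningful for \<open>k \<ge> 1\<close> only.
\<close>

definition power_sum :: "nat \<Rightarrow> (nat, 'a :: comm_ring_1) mps" where
  "power_sum k = Abs_mps (\<lambda>M. if \<exists>i\<ge>1. M = replicate_mset k i then 1 else 0)"

definition power_sum_part :: "nat multiset \<Rightarrow> (nat, 'a :: comm_ring_1) mps" where
  "power_sum_part \<mu> = (\<Prod>k\<in>#\<mu>. power_sum k)"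

definition c_coeff :: "nat \<Rightarrow> nat multiset \<Rightarrow> rat" where
  "c_coeff n \<mu> =
     (1 / 2 ^ size \<mu>) * (\<Sum>m = 1..n + 1. of_nat m ^ (size \<mu> - 1) * of_nat (n choose (m - 1)))"

end

theory Submission
  imports Defs "HOL-Computational_Algebra.Computational_Algebra"
begin

text \<open>
  Evaluate all series at rational values of the variables, with \<open>X\<close> marking the degree. Let \<open>W\<close>
  be the generating function of the trees without descents, the empty one included, and \<open>L a\<close> that of
  the trees which are empty or have root label at most \<open>a\<close>. As the trees that are empty or have
  root label at least \<open>a\<close> are counted by \<open>1 + W - L (a - 1)\<close>, removing the root gives
  \<open>L a - L (a - 1) = x\<^sub>a X L a (1 + W - L (a - 1))\<close>. With \<open>S = 1 + W\<close> this is the linear recurrence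
  \<open>1 / L a - 1 / S = (1 - x\<^sub>a X S) (1 / L (a - 1) - 1 / S)\<close>, whence
  \<open>W\<^sup>2 = \<Prod>\<^sub>a 1 / (1 - x\<^sub>a X S) = exp (\<Sum>\<^sub>k p\<^sub>k u\<^sup>k / k)\<close> for \<open>u = X S\<close>. Hence \<open>u = X (1 + e(u))\<close> with
  \<open>e(t) = exp (\<Sum>\<^sub>k p\<^sub>k t\<^sup>k / (2 k))\<close>, and Lagrange inversion expresses the coefficients of \<open>u\<close> by those
  of \<open>(1 + e)\<^bsup>n + 1\<^esup> = \<Sum>\<^sub>m (n + 1 choose m) e\<^sup>m\<close>, where \<open>e\<^sup>m\<close> is the sum of the
  \<open>(m / 2)\<^bsup>l(\<mu>)\<^esup> p\<^sub>\<mu> / z\<^sub>\<mu>\<close>.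
\<close>

section \<open>Lagrange inversion\<close>

text \<open>As \<open>b\<close> has no constant term, \<open>b ^ i\<close> vanishes below degree
  \<open>i\<close>, so cutting the composition off at \<open>n\<close> does not affect coefficients
  up to \<open>n\<close>.\<close>

lemma fps_mult_compose_nth:
  fixes a b c :: "'a::comm_ring_1 fps"
  assumes "b $ 0 = 0"
  shows "(c * (a oo b)) $ n = (\<Sum>i\<le>n. a $ i * (c * b ^ i) $ n)"
proof -
  have trunc: "(a oo b) $ m = (\<Sum>i\<le>n. a $ i * (b ^ i) $ m)" if "m \<le> n" for m
    unfolding fps_compose_nth
    by (rule sum.mono_neutral_left)
      (use that startsby_zero_power_prefix[OF assms] in auto)
  have "(c * (a oo b)) $ n = (\<Sum>k=0..n. c $ k * (\<Sum>i\<le>n. a $ i * (b ^ i) $ (n - k)))"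
    by (simp add: fps_mult_nth trunc)
  also have "\<dots> = (\<Sum>i\<le>n. a $ i * (c * b ^ i) $ n)"
    unfolding fps_mult_nth sum_distrib_left
    by (subst sum.swap) (simp add: mult_ac)
  finally show ?thesis .
qed

text \<open>The equation makes \<open>u\<close> the compositional inverse of
  \<open>g = fps_X * inverse \<phi>\<close>. Expanding \<open>fps_deriv u oo g\<close> in powers of
  \<open>g\<close> and multiplying by \<open>\<phi> ^ Suc n * fps_deriv g\<close> then isolates one
  coefficient of \<open>fps_deriv u\<close>, a residue argument without Laurent series.\<close>

theorem lagrange_inversion:
  fixes u \<phi> :: "'a::field_char_0 fps"
  assumes u: "u = fps_X * (\<phi> oo u)" and \<phi>0: "\<phi> $ 0 \<noteq> 0"
  shows "of_nat (Suc n) * u $ Suc n = (\<phi> ^ Suc n) $ n"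
proof -
  have u0: "u $ 0 = 0"
    by (subst u) simp
  define g where "g = fps_X * inverse \<phi>"
  have g0: "g $ 0 = 0" and g1: "g $ 1 \<noteq> 0"
    using \<phi>0 by (simp_all add: g_def)
  have gu: "g oo u = fps_X"
  proof -
    have "(\<phi> oo u) * (inverse \<phi> oo u) = 1"
      using inverse_mult_eq_1'[OF \<phi>0] u0
      by (metis fps_compose_1 fps_compose_mult_distrib)
    then have "u * (inverse \<phi> oo u) = fps_X"
      by (subst u) (simp add: mult.assoc)
    then show ?thesis
      by (simp add: g_def fps_compose_mult_distrib[OF u0] fps_X_fps_compose_startby0[OF u0])
  qed
  \<comment> \<open>So far \<open>u\<close> is only a right inverse of \<open>g\<close>; composing
    the left inverse \<open>fps_inv g\<close> with \<open>gu\<close> shows that the two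
    coincide.\<close>
  have "fps_inv g oo g = fps_X"
    by (rule fps_inv[OF g0 g1])
  then have "u = (fps_inv g oo g) oo u"
    by (simp add: fps_X_fps_compose_startby0[OF u0])
  also have "\<dots> = fps_inv g"
    by (simp add: fps_compose_assoc[OF u0 g0, symmetric] gu)
  finally have ug: "u oo g = fps_X"
    using fps_inv[OF g0 g1] by simp
  have der: "fps_deriv g * (fps_deriv u oo g) = 1"
    using fps_compose_deriv[OF g0, of u] ug by (simp add: mult.commute)
  \<comment> \<open>This is the residue of \<open>g\<^bsup>i - n - 1\<^esup> g'\<close>, cleared of negative powers.\<close>
  have coef: "(\<phi> ^ Suc n * fps_deriv g * g ^ i) $ n = (if i = n then 1 else 0)"
    if "i \<le> n" for i
  proof -
    obtain m where n: "n = i + m"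
      using le_Suc_ex[OF \<open>i \<le> n\<close>] by blast
    have cancel: "\<phi> ^ i * inverse \<phi> ^ i = 1"
      by (simp add: power_mult_distrib[symmetric] inverse_mult_eq_1'[OF \<phi>0])
    have "\<phi> ^ Suc n * fps_deriv g * g ^ i
        = (\<phi> ^ i * inverse \<phi> ^ i) * (fps_X ^ i * (\<phi> ^ Suc m * fps_deriv g))"
      unfolding n g_def power_mult_distrib by (simp add: power_add mult_ac)
    then have "(\<phi> ^ Suc n * fps_deriv g * g ^ i) $ n
        = (fps_X ^ i * (\<phi> ^ Suc m * fps_deriv g)) $ n"
      by (simp only: cancel mult_1_left)
    also have "\<dots> = (\<phi> ^ Suc m * fps_deriv g) $ m"
      by (simp add: n fps_X_power_mult_nth del: power_Suc)
    also have "\<phi> ^ Suc m * fps_deriv g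
        = \<phi> ^ Suc m * (inverse \<phi> - fps_X * fps_deriv \<phi> * (inverse \<phi>)\<^sup>2)"
      by (simp add: g_def fps_inverse_deriv[OF \<phi>0])
    also have "\<dots> = (\<phi> * inverse \<phi>) * \<phi> ^ m
          - (\<phi> * inverse \<phi>) * inverse \<phi> * fps_X * fps_deriv \<phi> * \<phi> ^ m"
      by (simp add: algebra_simps power2_eq_square)
    also have "\<dots> = \<phi> ^ m - fps_X * (inverse \<phi> * \<phi> ^ m * fps_deriv \<phi>)"
      using inverse_mult_eq_1'[OF \<phi>0] by (simp add: mult_ac)
    \<comment> \<open>For \<open>m > 0\<close> the two terms cancel:
      \<open>m * \<phi> ^ (m - 1) * fps_deriv \<phi>\<close> is the derivative of
      \<open>\<phi> ^ m\<close>, and characteristic zero allows division by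
      \<open>m\<close>.\<close>
    also have "\<dots> $ m = (if m = 0 then 1 else 0)"
    proof (cases m)
      case (Suc k)
      have inv: "inverse \<phi> * \<phi> ^ m * fps_deriv \<phi> = \<phi> ^ k * fps_deriv \<phi>"
        using inverse_mult_eq_1[OF \<phi>0] by (simp add: Suc mult.assoc[symmetric])
      have "of_nat m * (\<phi> ^ k * fps_deriv \<phi>) = fps_deriv (\<phi> ^ m)"
        unfolding fps_deriv_power' by (simp add: Suc mult_ac)
      then have "of_nat m * (\<phi> ^ k * fps_deriv \<phi>) $ k = of_nat m * (\<phi> ^ m) $ m"
        by (metis Suc fps_deriv_nth fps_mult_left_const_nth fps_of_nat Suc_eq_plus1)
      then have "(\<phi> ^ k * fps_deriv \<phi>) $ k = (\<phi> ^ m) $ m"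
        by (simp add: Suc del: of_nat_Suc power_Suc)
      moreover have "(\<phi> ^ m - fps_X * (\<phi> ^ k * fps_deriv \<phi>)) $ m
          = (\<phi> ^ m) $ m - (\<phi> ^ k * fps_deriv \<phi>) $ k"
        by (simp add: Suc del: power_Suc)
      ultimately show ?thesis
        unfolding inv by (simp add: Suc del: power_Suc)
    qed simp
    finally show ?thesis
      using n by auto
  qed
  have "(\<phi> ^ Suc n) $ n = (\<phi> ^ Suc n * fps_deriv g * (fps_deriv u oo g)) $ n"
    by (simp add: mult.assoc der)
  also have "\<dots> = (\<Sum>i\<le>n. fps_deriv u $ i * (if i = n then 1 else 0))"
    unfolding fps_mult_compose_nth[OF g0]
    by (rule sum.cong) (use coef in auto)
  also have "\<dots> = of_nat (Suc n) * u $ Suc n"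
    by (simp add: mult_delta_right)
  finally show ?thesis ..
qed

section \<open>Partitions and exponentials of power sums\<close>

text \<open>Only the factor at \<open>k\<close> changes: one more power of \<open>k\<close> and the
  next factorial.\<close>

lemma z_part_add_mset: "z_part (add_mset k \<mu>) = k * Suc (count \<mu> k) * z_part \<mu>"
proof -
  \<comment> \<open>The factor at \<open>k\<close> is split off even when \<open>k\<close> is absent
    from \<open>\<nu>\<close>, where it is 1, so that one formula serves both \<open>\<mu>\<close>
    and \<open>add_mset k \<mu>\<close>.\<close>
  have split: "z_part \<nu> = k ^ count \<nu> k * fact (count \<nu> k)
      * (\<Prod>i\<in>set_mset \<mu> - {k}. i ^ count \<nu> i * fact (count \<nu> i))"
    if "set_mset \<nu> - {k} = set_mset \<mu> - {k}" for \<nu>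
  proof (cases "k \<in># \<nu>")
    case True
    then show ?thesis
      by (simp add: z_part_def prod.remove[of _ k] that)
  next
    case False
    then have "set_mset \<nu> = set_mset \<mu> - {k}" "count \<nu> k = 0"
      using that by (auto simp: not_in_iff)
    then show ?thesis by (simp add: z_part_def)
  qed
  have rest: "(\<Prod>i\<in>set_mset \<mu> - {k}. i ^ count (add_mset k \<mu>) i * fact (count (add_mset k \<mu>) i))
      = (\<Prod>i\<in>set_mset \<mu> - {k}. i ^ count \<mu> i * fact (count \<mu> i))"
    by (rule prod.cong) auto
  show ?thesis
    unfolding split[of "add_mset k \<mu>", simplified, unfolded rest[simplified]] split[of \<mu>, simplified]
    by (simp add: algebra_simps)
qed

lemma sum_mset_eq_sum_count:
  fixes \<mu> :: "nat multiset"
  assumes "finite S" "set_mset \<mu> \<subseteq> S"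
  shows "sum_mset \<mu> = (\<Sum>k\<in>S. k * count \<mu> k)"
  using assms(2)
proof (induction \<mu>)
  case (add k \<mu>)
  have "(\<Sum>i\<in>S. i * count (add_mset k \<mu>) i) = (\<Sum>i\<in>S. i * count \<mu> i + (if i = k then k else 0))"
    by (rule sum.cong) auto
  with add assms(1) show ?case
    by (simp add: sum.distrib)
qed simp

lemma z_part_pos: "0 \<notin># \<mu> \<Longrightarrow> z_part \<mu> > 0"
  by (auto simp: z_part_def intro!: prod_pos gr0I)

text \<open>The generating function of the cycle indices of the symmetric groups, with weight
  \<open>c\<close> per cycle; for \<open>c = 1\<close> and power sums \<open>p\<close> its
  coefficients are the complete homogeneous symmetric functions.\<close>

definition cycle_index_fps :: "'a::field_char_0 \<Rightarrow> (nat \<Rightarrow> 'a) \<Rightarrow> 'a fps" where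
  "cycle_index_fps c p = Abs_fps (\<lambda>n. \<Sum>\<mu>\<in>partitions n.
     c ^ size \<mu> * (\<Prod>k\<in>#\<mu>. p k) / of_nat (z_part \<mu>))"

lemma partitions_0: "partitions 0 = {{#}}"
proof (intro equalityI subsetI)
  fix \<mu> assume "\<mu> \<in> partitions 0"
  then show "\<mu> \<in> {{#}}"
    by (cases \<mu>) (auto simp: partitions_def)
qed (simp add: partitions_def)

text \<open>Write \<open>n\<close> as the sum of \<open>k\<close> times the multiplicity of \<open>k\<close> in \<open>\<mu>\<close>, and remove one part \<open>k\<close>.\<close>

lemma cycle_index_fps_recurrence:
  "of_nat n * cycle_index_fps c p $ n = c * (\<Sum>k=1..n. p k * cycle_index_fps c p $ (n - k))"
proof -
  let ?w = "\<lambda>\<mu>. c ^ size \<mu> * (\<Prod>k\<in>#\<mu>. p k) / of_nat (z_part \<mu>)"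
  have step: "of_nat (k * count (add_mset k \<nu>) k) * ?w (add_mset k \<nu>) = c * p k * ?w \<nu>"
    if "k \<ge> 1" "0 \<notin># \<nu>" for k \<nu>
  proof -
    define m :: 'a where "m = of_nat (k * Suc (count \<nu> k))"
    have "m \<noteq> 0"
      unfolding m_def of_nat_eq_0_iff using that by simp
    moreover have "of_nat (z_part (add_mset k \<nu>)) = m * of_nat (z_part \<nu>)"
      by (simp add: z_part_add_mset m_def)
    moreover have "of_nat (k * count (add_mset k \<nu>) k) = m"
      by (simp add: m_def)
    ultimately show ?thesis
      by (simp add: mult_ac)
  qed
  have "of_nat n * cycle_index_fps c p $ n
      = (\<Sum>\<mu>\<in>partitions n. \<Sum>k\<in>set_mset \<mu>. of_nat (k * count \<mu> k) * ?w \<mu>)"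
    unfolding cycle_index_fps_def fps_nth_Abs_fps sum_distrib_left
  proof (rule sum.cong)
    fix \<mu> assume "\<mu> \<in> partitions n"
    then have n: "n = (\<Sum>k\<in>set_mset \<mu>. k * count \<mu> k)"
      by (simp add: partitions_def flip: sum_mset_eq_sum_count)
    show "of_nat n * ?w \<mu> = (\<Sum>k\<in>set_mset \<mu>. of_nat (k * count \<mu> k) * ?w \<mu>)"
      by (subst n) (simp only: of_nat_sum sum_distrib_right)
  qed simp
  also have "\<dots> = (\<Sum>(\<mu>, k)\<in>(SIGMA \<mu>:partitions n. set_mset \<mu>). of_nat (k * count \<mu> k) * ?w \<mu>)"
    by (rule sum.Sigma) (auto simp: finite_partitions)
  also have "\<dots> = (\<Sum>(k, \<nu>)\<in>(SIGMA k:{1..n}. partitions (n - k)). c * p k * ?w \<nu>)"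
  proof (rule sum.reindex_bij_witness[where
        i = "\<lambda>(k, \<nu>). (add_mset k \<nu>, k)" and j = "\<lambda>(\<mu>, k). (k, \<mu> - {#k#})"])
    fix a assume "a \<in> (SIGMA \<mu>:partitions n. set_mset \<mu>)"
    then obtain k \<nu> where a: "a = (add_mset k \<nu>, k)" "add_mset k \<nu> \<in> partitions n"
      by (auto dest: multi_member_split)
    then have k: "k \<ge> 1" "k \<le> n" "0 \<notin># \<nu>" "sum_mset \<nu> = n - k"
      by (auto simp: partitions_def)
    show "(\<lambda>(k, \<nu>). (add_mset k \<nu>, k)) ((\<lambda>(\<mu>, k). (k, \<mu> - {#k#})) a) = a"
      "(\<lambda>(\<mu>, k). (k, \<mu> - {#k#})) a \<in> (SIGMA k:{1..n}. partitions (n - k))"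
      using a k by (auto simp: partitions_def)
    show "(case (\<lambda>(\<mu>, k). (k, \<mu> - {#k#})) a of (k, \<nu>) \<Rightarrow> c * p k * ?w \<nu>)
        = (case a of (\<mu>, k) \<Rightarrow> of_nat (k * count \<mu> k) * ?w \<mu>)"
      by (simp only: a(1) prod.case add_mset_remove_trivial step[OF k(1,3)])
  qed (auto simp: partitions_def)
  also have "\<dots> = (\<Sum>k=1..n. \<Sum>\<nu>\<in>partitions (n - k). c * p k * ?w \<nu>)"
    by (rule sum.Sigma[symmetric]) (auto simp: finite_partitions)
  also have "\<dots> = c * (\<Sum>k=1..n. p k * cycle_index_fps c p $ (n - k))"
    by (simp add: cycle_index_fps_def sum_distrib_left mult_ac)
  finally show ?thesis .
qed

text \<open>For power sums \<open>p\<close> this is the logarithm of the product of all 1 / (1 - x_a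
  t). The value 0 at index 0 makes it a valid argument of composition.\<close>

definition power_sum_fps :: "(nat \<Rightarrow> 'a::field_char_0) \<Rightarrow> 'a fps" where
  "power_sum_fps p = Abs_fps (\<lambda>k. if k = 0 then 0 else p k / of_nat k)"

text \<open>Both series have constant term 1 and satisfy the same recurrence, which on the
  exponential side is its differential equation read off coefficientwise.\<close>

lemma cycle_index_fps_eq_exp:
  "cycle_index_fps c p = fps_exp c oo power_sum_fps p"
proof -
  let ?E = "fps_exp c oo power_sum_fps p"
  have psi0: "power_sum_fps p $ 0 = 0"
    by (simp add: power_sum_fps_def)
  have E': "fps_deriv ?E = fps_const c * fps_deriv (power_sum_fps p) * ?E"
    by (simp add: fps_compose_deriv[OF psi0] fps_compose_mult_distrib[OF psi0] mult_ac)
  have rec: "of_nat n * ?E $ n = c * (\<Sum>k=1..n. p k * ?E $ (n - k))" for n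
  proof (cases n)
    case (Suc m)
    have "of_nat n * ?E $ n = fps_deriv ?E $ m"
      by (simp add: Suc)
    also have "\<dots> = c * (fps_deriv (power_sum_fps p) * ?E) $ m"
      unfolding E' mult.assoc fps_mult_left_const_nth ..
    also have "(fps_deriv (power_sum_fps p) * ?E) $ m = (\<Sum>k=0..m. p (Suc k) * ?E $ (m - k))"
      by (simp add: fps_mult_nth power_sum_fps_def del: of_nat_Suc)
    also have "\<dots> = (\<Sum>k=1..n. p k * ?E $ (n - k))"
      by (simp add: Suc sum.shift_bounds_cl_Suc_ivl del: sum.cl_ivl_Suc)
    finally show ?thesis .
  qed simp
  have "cycle_index_fps c p $ n = ?E $ n" for n
  proof (induction n rule: less_induct)
    case (less n)
    show ?case
    proof (cases "n = 0")
      case True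
      then show ?thesis
        by (simp add: cycle_index_fps_def partitions_0 z_part_def)
    next
      case False
      have "of_nat n * cycle_index_fps c p $ n = of_nat n * ?E $ n"
        unfolding rec cycle_index_fps_recurrence
        by (intro arg_cong[of _ _ "(*) c"] sum.cong) (use less in auto)
      with False show ?thesis by simp
    qed
  qed
  then show ?thesis
    by (simp add: fps_eq_iff)
qed

text \<open>Logarithmic differentiation of the product, written without inverses:
  \<open>power_sum_fps\<close> is additive over the set of variables, so one factor at a time
  suffices.\<close>

lemma deriv_power_sum_fps_mult_prod:
  fixes x :: "nat \<Rightarrow> 'a::field_char_0"
  assumes "finite A"
  shows "fps_deriv (power_sum_fps (\<lambda>k. \<Sum>a\<in>A. x a ^ k)) * (\<Prod>a\<in>A. 1 - fps_const (x a) * fps_X)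
    = - fps_deriv (\<Prod>a\<in>A. 1 - fps_const (x a) * fps_X)"
  using assms
proof (induction A)
  case empty
  have "power_sum_fps (\<lambda>k. 0) = (0 :: 'a fps)"
    by (simp add: power_sum_fps_def fps_eq_iff)
  then show ?case by simp
next
  case (insert b A)
  define \<psi> where "\<psi> = power_sum_fps (\<lambda>k. x b ^ k)"
  define \<psi>' where "\<psi>' = power_sum_fps (\<lambda>k. \<Sum>a\<in>A. x a ^ k)"
  define q where "q = 1 - fps_const (x b) * fps_X"
  define Q where "Q = (\<Prod>a\<in>A. 1 - fps_const (x a) * fps_X)"
  have sum: "power_sum_fps (\<lambda>k. \<Sum>a\<in>insert b A. x a ^ k) = \<psi> + \<psi>'"
    using insert.hyps
    by (simp add: \<psi>_def \<psi>'_def power_sum_fps_def fps_eq_iff add_divide_distrib)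
  \<comment> \<open>For one variable the derivative is the geometric series x_b / (1 - x_b
    X).\<close>
  have \<psi>q: "fps_deriv \<psi> * q = fps_const (x b)"
  proof (rule fps_ext)
    fix n
    have "fps_deriv \<psi> * q = fps_deriv \<psi> - fps_const (x b) * (fps_X * fps_deriv \<psi>)"
      by (simp add: q_def algebra_simps)
    then show "(fps_deriv \<psi> * q) $ n = fps_const (x b) $ n"
      by (cases n) (simp_all add: \<psi>_def power_sum_fps_def del: of_nat_Suc)
  qed
  have "fps_deriv (\<psi> + \<psi>') * (q * Q) = fps_deriv \<psi> * q * Q + q * (fps_deriv \<psi>' * Q)"
    by (simp add: algebra_simps)
  also have "\<dots> = fps_const (x b) * Q - q * fps_deriv Q"
    using insert.IH by (simp add: \<psi>q \<psi>'_def Q_def)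
  also have "\<dots> = - fps_deriv (q * Q)"
    by (simp add: q_def algebra_simps)
  finally show ?case
    using insert.hyps unfolding sum by (simp add: q_def Q_def)
qed

text \<open>By the preceding lemma the derivative of the left-hand side vanishes, so it equals its
  constant term.\<close>

lemma exp_power_sum_fps_mult_prod:
  fixes x :: "nat \<Rightarrow> 'a::field_char_0"
  assumes "finite A"
  shows "(fps_exp 1 oo power_sum_fps (\<lambda>k. \<Sum>a\<in>A. x a ^ k))
    * (\<Prod>a\<in>A. 1 - fps_const (x a) * fps_X) = 1"
proof -
  define \<psi> where "\<psi> = power_sum_fps (\<lambda>k. \<Sum>a\<in>A. x a ^ k)"
  define Q where "Q = (\<Prod>a\<in>A. 1 - fps_const (x a) * fps_X)"
  have \<psi>0: "\<psi> $ 0 = 0"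
    by (simp add: \<psi>_def power_sum_fps_def)
  have "fps_deriv ((fps_exp 1 oo \<psi>) * Q) = (fps_exp 1 oo \<psi>) * (fps_deriv \<psi> * Q + fps_deriv Q)"
    by (simp add: fps_compose_deriv[OF \<psi>0] algebra_simps)
  also have "\<dots> = 0"
    using deriv_power_sum_fps_mult_prod[OF assms, of x] by (simp add: \<psi>_def Q_def)
  finally have "(fps_exp 1 oo \<psi>) * Q = fps_const (((fps_exp 1 oo \<psi>) * Q) $ 0)"
    unfolding fps_deriv_eq_0_iff .
  also have "Q $ 0 = 1"
    unfolding Q_def using assms by induction auto
  then have "fps_const (((fps_exp 1 oo \<psi>) * Q) $ 0) = 1"
    by simp
  finally show ?thesis
    by (simp add: \<psi>_def Q_def)
qed

section \<open>Evaluation of series in many variables\<close>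

text \<open>Variables outside \<open>A\<close> are set to 0. For finite \<open>A\<close> each degree
  contributes a finite sum, and grading by degree avoids any question of convergence.\<close>

definition mps_eval :: "'v set \<Rightarrow> ('v \<Rightarrow> 'a) \<Rightarrow> ('v, 'a::comm_ring_1) mps \<Rightarrow> 'a fps" where
  "mps_eval A x F =
     Abs_fps (\<lambda>n. \<Sum>M\<in>multisets_of_size A n. mps_coeff F M * (\<Prod>i\<in>#M. x i))"

lemma mps_eval_nth:
  "mps_eval A x F $ n = (\<Sum>M\<in>multisets_of_size A n. mps_coeff F M * (\<Prod>i\<in>#M. x i))"
  by (simp add: mps_eval_def)

lemma mps_eval_0 [simp]: "mps_eval A x 0 = 0"
  by (simp add: fps_eq_iff mps_eval_nth zero_mps_def)

lemma mps_eval_add: "mps_eval A x (F + G) = mps_eval A x F + mps_eval A x G"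
  by (simp add: fps_eq_iff mps_eval_nth plus_mps_def distrib_right sum.distrib)

lemma mps_eval_sum: "mps_eval A x (\<Sum>i\<in>I. F i) = (\<Sum>i\<in>I. mps_eval A x (F i))"
  by (induction I rule: infinite_finite_induct) (simp_all add: mps_eval_add)

lemma mps_eval_const:
  assumes "finite A"
  shows "mps_eval A x (mps_const c) = fps_const c"
proof (rule fps_ext)
  fix n
  have "mps_eval A x (mps_const c) $ n
      = (\<Sum>M\<in>multisets_of_size A n. if M = {#} then c else 0)"
    unfolding mps_eval_nth mps_const_def mps_coeff_Abs by (rule sum.cong) auto
  also have "\<dots> = fps_const c $ n"
    using finite_multisets_of_size[OF assms, of n]
    by (auto simp: multisets_of_size_def)
  finally show "mps_eval A x (mps_const c) $ n = fps_const c $ n" .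
qed

lemma mps_const_1: "mps_const 1 = 1"
  by (simp add: mps_const_def one_mps_def)

lemma mps_eval_mult:
  assumes "finite A"
  shows "mps_eval A x (F * G) = mps_eval A x F * mps_eval A x G"
proof (rule fps_ext)
  fix n
  let ?m = "multisets_of_size A"
  let ?w = "\<lambda>(B, C). mps_coeff F B * mps_coeff G C * (\<Prod>i\<in>#B + C. x i)"
  have "mps_eval A x (F * G) $ n
      = (\<Sum>M\<in>?m n. \<Sum>p\<in>{(B, C). B + C = M}. ?w p)"
    by (auto simp: mps_eval_nth times_mps_def sum_distrib_right intro!: sum.cong)
  also have "\<dots> = (\<Sum>(M, p)\<in>(SIGMA M:?m n. {(B, C). B + C = M}). ?w p)"
    by (rule sum.Sigma) (auto simp: finite_mset_splits finite_multisets_of_size[OF assms])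
  \<comment> \<open>Splittings of monomials of degree \<open>n\<close> are regrouped by the degree
    \<open>i\<close> of the first factor.\<close>
  also have "\<dots> = (\<Sum>(i, p)\<in>(SIGMA i:{0..n}. ?m i \<times> ?m (n - i)). ?w p)"
    by (rule sum.reindex_bij_witness[where
          i = "\<lambda>(i, (B, C)). (B + C, (B, C))" and j = "\<lambda>(M, (B, C)). (size B, (B, C))"])
      (auto simp: multisets_of_size_def)
  also have "\<dots> = (\<Sum>i=0..n. \<Sum>p\<in>?m i \<times> ?m (n - i). ?w p)"
    by (rule sum.Sigma[symmetric]) (auto simp: finite_multisets_of_size[OF assms])
  also have "\<dots> = (mps_eval A x F * mps_eval A x G) $ n"
    by (simp add: fps_mult_nth mps_eval_nth sum_product sum.cartesian_product mult_ac)
  finally show "mps_eval A x (F * G) $ n = (mps_eval A x F * mps_eval A x G) $ n" .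
qed

text \<open>
  Substituting the \<open>j\<close>-th powers of distinct primes for the variables turns distinct monomials
  into the \<open>j\<close>-th powers of distinct integers, and Lagrange interpolation at these integers
  isolates a single coefficient.
\<close>

lemma mps_eqI_eval:
  fixes F G :: "(nat, 'a::field_char_0) mps"
  assumes eval: "\<And>N x. mps_eval {..N} x F = mps_eval {..N} x G"
  shows "F = G"
proof (rule mps_eqI)
  fix M :: "nat multiset"
  define p where "p = enumerate {q::nat. prime q}"
  have p: "prime (p i)" for i
    using enumerate_in_set[OF primes_infinite, of i] by (simp add: p_def)
  have "inj p"
    unfolding p_def using primes_infinite
    by (intro strict_mono_imp_inj_on) (simp add: strict_mono_enumerate)
  define v where "v M = (\<Prod>i\<in>#M. p i)" for M
  have "inj v"
  proof (rule injI)
    fix M M' assume "v M = v M'"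
    moreover have "prime_factorization (v M) = image_mset p M" for M
      unfolding v_def by (rule prime_factorization_prod_mset_primes) (auto simp: p)
    ultimately show "M = M'"
      using injD[OF multiset.inj_map[OF \<open>inj p\<close>]] by metis
  qed
  \<comment> \<open>\<open>insert 0\<close> keeps \<open>Max\<close> defined when \<open>M\<close>
    is empty.\<close>
  define \<M> where "\<M> = multisets_of_size {..Max (insert 0 (set_mset M))} (size M)"
  have "finite \<M>"
    unfolding \<M>_def by (intro finite_multisets_of_size finite_atMost)
  have "M \<in> \<M>"
    by (auto simp: \<M>_def multisets_of_size_def)
  define d where "d M = mps_coeff F M - mps_coeff G M" for M
  have pow: "(\<Prod>i\<in>#M. of_nat (p i) ^ j) = (of_nat (v M) :: 'a) ^ j" for M j
    by (induction M) (simp_all add: v_def power_mult_distrib)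
  have moment: "(\<Sum>M\<in>\<M>. d M * of_nat (v M) ^ j) = 0" for j
    using arg_cong[OF eval[of "Max (insert 0 (set_mset M))" "\<lambda>i. of_nat (p i) ^ j"],
        of "\<lambda>f. f $ size M"]
    by (simp add: mps_eval_nth pow d_def left_diff_distrib sum_subtractf \<M>_def)
  define Q :: "'a poly" where "Q = (\<Prod>M'\<in>\<M> - {M}. [:- of_nat (v M'), 1:])"
  have "(\<Sum>M'\<in>\<M>. d M' * poly Q (of_nat (v M')))
      = (\<Sum>j\<le>degree Q. coeff Q j * (\<Sum>M'\<in>\<M>. d M' * of_nat (v M') ^ j))"
    unfolding poly_altdef sum_distrib_left by (subst sum.swap) (simp add: mult_ac)
  then have "0 = (\<Sum>M'\<in>\<M>. d M' * poly Q (of_nat (v M')))"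
    by (simp add: moment)
  also have "\<dots> = d M * poly Q (of_nat (v M))"
  proof -
    have "(\<Sum>M'\<in>\<M> - {M}. d M' * poly Q (of_nat (v M'))) = 0"
    proof (rule sum.neutral, rule ballI)
      fix M' assume "M' \<in> \<M> - {M}"
      then have "poly Q (of_nat (v M')) = 0"
        unfolding Q_def poly_prod using \<open>finite \<M>\<close> by (intro prod_zero) auto
      then show "d M' * poly Q (of_nat (v M')) = 0" by simp
    qed
    then show ?thesis
      by (simp add: sum.remove[OF \<open>finite \<M>\<close> \<open>M \<in> \<M>\<close>])
  qed
  finally have "d M * poly Q (of_nat (v M)) = 0" ..
  moreover have "poly Q (of_nat (v M)) \<noteq> 0"
    using \<open>finite \<M>\<close> injD[OF \<open>inj v\<close>] by (auto simp: Q_def poly_prod)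
  ultimately show "mps_coeff F M = mps_coeff G M"
    by (simp add: d_def)
qed

lemma mps_eval_power_sum:
  assumes "k \<ge> 1"
  shows "mps_eval {..N} x (power_sum k :: (nat, 'a::comm_ring_1) mps)
    = fps_const (\<Sum>a=1..N. x a ^ k) * fps_X ^ k"
proof (rule fps_ext)
  fix n
  \<comment> \<open>The index 0 lies in \<open>{..N}\<close> but does not occur in
    \<open>power_sum\<close>, so \<open>x 0\<close> drops out.\<close>
  let ?R = "replicate_mset k ` {1..N}"
  have inj: "inj_on (replicate_mset k) {1..N}"
    using assms by (auto simp: inj_on_def replicate_mset_eq_iff)
  have pr: "(\<Prod>i\<in>#replicate_mset k a. x i) = x a ^ k" for a
    by simp
  show "mps_eval {..N} x (power_sum k) $ n = (fps_const (\<Sum>a=1..N. x a ^ k) * fps_X ^ k) $ n"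
  proof (cases "n = k")
    case True
    have coeff: "mps_coeff (power_sum k) M = (if M \<in> ?R then 1 else 0 :: 'a)"
      if "set_mset M \<subseteq> {..N}" for M
    proof -
      have "(\<exists>i\<ge>1. M = replicate_mset k i) \<longleftrightarrow> M \<in> ?R"
        using that assms by (auto simp: image_iff)
      then show ?thesis by (simp add: power_sum_def)
    qed
    have fin: "finite (multisets_of_size {..N} n)"
      by (simp add: finite_multisets_of_size)
    have "mps_eval {..N} x (power_sum k) $ n
        = (\<Sum>M\<in>?R. \<Prod>i\<in>#M. x i)"
      unfolding mps_eval_nth
      by (rule sum.mono_neutral_cong_right)
        (use True fin in \<open>auto simp: coeff multisets_of_size_def split: if_splits\<close>)
    also have "\<dots> = (\<Sum>a=1..N. x a ^ k)"
      unfolding sum.reindex[OF inj] by simp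
    finally show ?thesis
      using True by simp
  next
    case False
    then show ?thesis
      unfolding mps_eval_nth by (auto simp: power_sum_def multisets_of_size_def intro!: sum.neutral)
  qed
qed

lemma mps_eval_power_sum_part:
  assumes "0 \<notin># \<mu>"
  shows "mps_eval {..N} x (power_sum_part \<mu>)
    = fps_const (\<Prod>k\<in>#\<mu>. \<Sum>a=1..N. x a ^ k) * fps_X ^ sum_mset \<mu>"
  using assms
proof (induction \<mu>)
  case empty
  then show ?case
    using mps_eval_const[of "{..N}" x 1] by (simp add: power_sum_part_def mps_const_1)
next
  case (add k \<mu>)
  have "power_sum_part (add_mset k \<mu>) = power_sum k * (power_sum_part \<mu> :: (nat, 'a) mps)"
    by (simp add: power_sum_part_def)
  with add show ?case
    by (simp add: mps_eval_mult mps_eval_power_sum power_add mult_ac fps_const_mult[symmetric]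
        del: fps_const_mult)
qed

section \<open>Trees without descents\<close>

text \<open>Trees are summed directly, bypassing \<open>mps\<close>, so that unions of tree sets and
  removal of the root become sums and products of series.\<close>

definition tree_fps :: "'v set \<Rightarrow> ('v \<Rightarrow> 'a) \<Rightarrow> 'v tree set \<Rightarrow> 'a::comm_ring_1 fps" where
  "tree_fps A x P =
     Abs_fps (\<lambda>n. \<Sum>T | T \<in> P \<and> set_tree T \<subseteq> A \<and> size T = n. \<Prod>i\<in>#mset_tree T. x i)"

lemma tree_fps_nth:
  "tree_fps A x P $ n = (\<Sum>T | T \<in> P \<and> set_tree T \<subseteq> A \<and> size T = n. \<Prod>i\<in>#mset_tree T. x i)"
  by (simp add: tree_fps_def)

lemma finite_trees_in:
  assumes "finite A"
  shows "finite {T. T \<in> P \<and> set_tree T \<subseteq> A \<and> size T = n}"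
  by (rule finite_subset[OF _ finite_trees_size[OF assms, of n]]) auto

lemma tree_fps_cong:
  assumes "\<And>T. set_tree T \<subseteq> A \<Longrightarrow> T \<in> P \<longleftrightarrow> T \<in> P'"
  shows "tree_fps A x P = tree_fps A x P'"
  unfolding tree_fps_def using assms by (intro arg_cong[of _ _ Abs_fps] ext sum.cong) auto

lemma tree_fps_Leaf: "tree_fps A x {\<langle>\<rangle>} = 1"
proof (rule fps_ext)
  fix n
  have "{T. T \<in> {\<langle>\<rangle>} \<and> set_tree T \<subseteq> A \<and> size T = n} = (if n = 0 then {\<langle>\<rangle>} else {})"
    by auto
  then show "tree_fps A x {\<langle>\<rangle>} $ n = 1 $ n"
    unfolding tree_fps_nth by (simp only:) simp
qed

text \<open>Overlap is allowed for the sake of sets that share the empty tree.\<close>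

lemma tree_fps_Un:
  assumes "finite A"
  shows "tree_fps A x (P \<union> P') + tree_fps A x (P \<inter> P') = tree_fps A x P + tree_fps A x P'"
proof (rule fps_ext)
  fix n
  let ?S = "\<lambda>P. {T. T \<in> P \<and> set_tree T \<subseteq> A \<and> size T = n}"
  have "?S (P \<union> P') = ?S P \<union> ?S P'" "?S (P \<inter> P') = ?S P \<inter> ?S P'"
    by auto
  then show "(tree_fps A x (P \<union> P') + tree_fps A x (P \<inter> P')) $ n
      = (tree_fps A x P + tree_fps A x P') $ n"
    using sum.union_inter[OF finite_trees_in[OF assms] finite_trees_in[OF assms]]
    by (simp add: tree_fps_nth)
qed

text \<open>The root contributes \<open>x a\<close> and one power of \<open>fps_X\<close>; the sizes
  of the two subtrees add up as in a Cauchy product.\<close>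

lemma tree_fps_Node:
  assumes "finite A" "a \<in> A"
  shows "tree_fps A x {\<langle>l, a, r\<rangle> |l r. l \<in> L \<and> r \<in> R}
    = fps_const (x a) * fps_X * (tree_fps A x L * tree_fps A x R)"
proof (rule fps_ext)
  fix n
  let ?S = "\<lambda>P n. {T. T \<in> P \<and> set_tree T \<subseteq> A \<and> size T = n}"
  let ?P = "{\<langle>l, a, r\<rangle> |l r. l \<in> L \<and> r \<in> R}"
  let ?w = "\<lambda>T. \<Prod>i\<in>#mset_tree T. x i"
  show "tree_fps A x ?P $ n = (fps_const (x a) * fps_X * (tree_fps A x L * tree_fps A x R)) $ n"
  proof (cases n)
    case 0
    then have "?S ?P n = {}" by auto
    then have "tree_fps A x ?P $ n = 0"
      unfolding tree_fps_nth by (simp only: sum.empty)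
    then show ?thesis
      by (simp add: 0 mult.assoc)
  next
    case (Suc m)
    have "tree_fps A x ?P $ n = (\<Sum>(i, l, r)\<in>(SIGMA i:{0..m}. ?S L i \<times> ?S R (m - i)). ?w \<langle>l, a, r\<rangle>)"
      unfolding tree_fps_nth
      by (rule sum.reindex_bij_witness[where
            i = "\<lambda>(i, l, r). \<langle>l, a, r\<rangle>" and j = "\<lambda>T. (size (left T), left T, right T)"])
        (use assms(2) Suc in auto)
    also have "\<dots> = (\<Sum>i=0..m. \<Sum>(l, r)\<in>?S L i \<times> ?S R (m - i). ?w \<langle>l, a, r\<rangle>)"
      by (rule sum.Sigma[symmetric]) (auto intro: finite_trees_in[OF assms(1)])
    also have "\<dots> = (\<Sum>i=0..m. x a * (tree_fps A x L $ i * tree_fps A x R $ (m - i)))"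
      unfolding tree_fps_nth sum_product
      unfolding sum.cartesian_product sum_distrib_left
      by (simp add: case_prod_unfold mult.assoc)
    also have "\<dots> = x a * (tree_fps A x L * tree_fps A x R) $ m"
      by (simp add: fps_mult_nth sum_distrib_left)
    finally show ?thesis
      by (simp add: Suc mult.assoc)
  qed
qed

section \<open>Root labels and root removal\<close>

definition ascent_trees :: "nat tree set" where
  "ascent_trees = {T. ldes T = 0 \<and> rdes T = 0}"

definition ascent_trees_le :: "nat \<Rightarrow> nat tree set" where
  "ascent_trees_le a = {T \<in> ascent_trees. T = \<langle>\<rangle> \<or> value T \<le> a}"

definition ascent_trees_ge :: "nat \<Rightarrow> nat tree set" where
  "ascent_trees_ge a = {T \<in> ascent_trees. T = \<langle>\<rangle> \<or> a \<le> value T}"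

lemma Leaf_in_ascent_trees: "\<langle>\<rangle> \<in> ascent_trees"
  by (simp add: ascent_trees_def ldes_def rdes_def)

lemma Node_in_ascent_trees_iff:
  "\<langle>l, a, r\<rangle> \<in> ascent_trees \<longleftrightarrow> l \<in> ascent_trees_le a \<and> r \<in> ascent_trees_ge a"
  by (cases l; cases r)
    (auto simp: ascent_trees_def ascent_trees_le_def ascent_trees_ge_def ldes_def rdes_def)

lemma ascent_trees_root:
  "{T \<in> ascent_trees. T \<noteq> \<langle>\<rangle> \<and> value T = a}
    = {\<langle>l, a, r\<rangle> |l r. l \<in> ascent_trees_le a \<and> r \<in> ascent_trees_ge a}"
proof (intro set_eqI iffI)
  fix T assume "T \<in> {T \<in> ascent_trees. T \<noteq> \<langle>\<rangle> \<and> value T = a}"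
  then show "T \<in> {\<langle>l, a, r\<rangle> |l r. l \<in> ascent_trees_le a \<and> r \<in> ascent_trees_ge a}"
    by (cases T) (auto simp: Node_in_ascent_trees_iff)
qed (auto simp: Node_in_ascent_trees_iff)

text \<open>The weight 0 of descents, with \<open>0 ^ 0 = 1\<close>, keeps exactly the trees without
  them. All monomials have degree \<open>n\<close>, and positivity of labels replaces
  \<open>{..N}\<close> by \<open>{1..N}\<close>.\<close>

lemma mps_eval_tree_gf:
  fixes x :: "nat \<Rightarrow> 'a::comm_ring_1"
  shows "mps_eval {..N} x (tree_gf n 1 0 1 0)
    = fps_const (tree_fps {1..N} x ascent_trees $ n) * fps_X ^ n"
proof (rule fps_ext)
  fix m
  let ?U = "{T \<in> labeled_trees n. set_tree T \<subseteq> {..N}}"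
  let ?w = "\<lambda>T. (if T \<in> ascent_trees then 1 else 0) * (\<Prod>i\<in>#mset_tree T. x i)"
  have "mps_eval {..N} x (tree_gf n 1 0 1 0) $ m
      = (\<Sum>M\<in>multisets_of_size {..N} m. \<Sum>T | T \<in> labeled_trees n \<and> mset_tree T = M. ?w T)"
    unfolding mps_eval_nth tree_gf_def mps_coeff_Abs sum_distrib_right
    by (intro sum.cong) (auto simp: ascent_trees_def power_0_left)
  also have "\<dots> = (if m = n then \<Sum>T\<in>?U. ?w T else 0)"
  proof (cases "m = n")
    case True
    have fin: "finite ?U" "finite (multisets_of_size {..N} n)"
      by (rule finite_subset[OF _ finite_trees_size[of "{..N}" n]])
        (auto simp: labeled_trees_def finite_multisets_of_size)
    have "(\<Sum>M\<in>multisets_of_size {..N} n. \<Sum>T | T \<in> labeled_trees n \<and> mset_tree T = M. ?w T)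
        = (\<Sum>M\<in>multisets_of_size {..N} n. \<Sum>T | T \<in> ?U \<and> mset_tree T = M. ?w T)"
      by (intro sum.cong) (auto simp: multisets_of_size_def simp flip: set_mset_tree)
    also have "\<dots> = (\<Sum>T\<in>?U. ?w T)"
      by (rule sum.group[OF fin]) (auto simp: multisets_of_size_def labeled_trees_def)
    finally show ?thesis
      using True by simp
  next
    case False
    have "(\<Sum>M\<in>multisets_of_size {..N} m. \<Sum>T | T \<in> labeled_trees n \<and> mset_tree T = M. ?w T) = 0"
      by (intro sum.neutral ballI) (use False in \<open>auto simp: multisets_of_size_def labeled_trees_def\<close>)
    then show ?thesis
      by (simp only: False if_False)
  qed
  also have "(\<Sum>T\<in>?U. ?w T) = tree_fps {1..N} x ascent_trees $ n"
    unfolding tree_fps_nth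
    by (rule sum.mono_neutral_cong_right)
      (auto simp: labeled_trees_def Ball_def subset_iff
        intro: finite_subset[OF _ finite_trees_size[of "{..N}" n]])
  finally show "mps_eval {..N} x (tree_gf n 1 0 1 0) $ m
      = (fps_const (tree_fps {1..N} x ascent_trees $ n) * fps_X ^ n) $ m"
    by simp
qed

lemma ascent_trees_functional_equation:
  fixes N :: nat and x :: "nat \<Rightarrow> 'a::comm_ring_1"
  defines "W \<equiv> tree_fps {1..N} x ascent_trees"
  shows "W * W * (\<Prod>a=1..N. 1 - fps_const (x a) * (fps_X * (1 + W))) = 1"
proof -
  define L where "L a = tree_fps {1..N} x (ascent_trees_le a)" for a
  define q where "q a = 1 - fps_const (x a) * (fps_X * (1 + W))" for a
  have L0: "L 0 = 1"
    unfolding L_def tree_fps_Leaf[of "{1..N}" x, symmetric]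
  proof (rule tree_fps_cong)
    fix T :: "nat tree" assume "set_tree T \<subseteq> {1..N}"
    then show "T \<in> ascent_trees_le 0 \<longleftrightarrow> T \<in> {\<langle>\<rangle>}"
      by (cases T) (auto simp: ascent_trees_le_def Leaf_in_ascent_trees)
  qed
  have LN: "L N = W"
    unfolding L_def W_def
  proof (rule tree_fps_cong)
    fix T :: "nat tree" assume "set_tree T \<subseteq> {1..N}"
    then show "T \<in> ascent_trees_le N \<longleftrightarrow> T \<in> ascent_trees"
      by (cases T) (auto simp: ascent_trees_le_def)
  qed
  \<comment> \<open>The summand 1 is the empty tree, which belongs to both sets.\<close>
  have R: "tree_fps {1..N} x (ascent_trees_ge (Suc a)) = 1 + W - L a" for a
  proof -
    have "ascent_trees_le a \<union> ascent_trees_ge (Suc a) = ascent_trees"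
      "ascent_trees_le a \<inter> ascent_trees_ge (Suc a) = {\<langle>\<rangle>}"
      using Leaf_in_ascent_trees by (auto simp: ascent_trees_le_def ascent_trees_ge_def)
    then show ?thesis
      using tree_fps_Un[of "{1..N}" x "ascent_trees_le a" "ascent_trees_ge (Suc a)"]
      by (simp add: tree_fps_Leaf L_def W_def algebra_simps)
  qed
  \<comment> \<open>The new trees have root label \<open>Suc a\<close>. Equal labels are ascents, so
    the left subtree is counted by \<open>L (Suc a)\<close>, not \<open>L a\<close>.\<close>
  have step: "L (Suc a) = L a + fps_const (x (Suc a)) * fps_X * (L (Suc a) * (1 + W - L a))"
    if "Suc a \<le> N" for a
  proof -
    let ?V = "{T \<in> ascent_trees. T \<noteq> \<langle>\<rangle> \<and> value T = Suc a}"
    have "ascent_trees_le a \<union> ?V = ascent_trees_le (Suc a)" "ascent_trees_le a \<inter> ?V = {}"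
      by (auto simp: ascent_trees_le_def)
    moreover have "tree_fps {1..N} x {} = 0"
      by (simp add: fps_eq_iff tree_fps_nth)
    ultimately have "L (Suc a) = L a + tree_fps {1..N} x ?V"
      using tree_fps_Un[of "{1..N}" x "ascent_trees_le a" ?V] by (simp add: L_def)
    also have "tree_fps {1..N} x ?V
        = fps_const (x (Suc a)) * fps_X * (L (Suc a) * (1 + W - L a))"
      using that R[of a] tree_fps_Node[of "{1..N}" "Suc a" x]
      unfolding ascent_trees_root by (simp add: L_def)
    finally show ?thesis .
  qed
  \<comment> \<open>The solved recurrence for \<open>1 / L a - 1 / (1 + W)\<close>, cleared of denominators.\<close>
  have "1 + W - L a = L a * W * (\<Prod>b=1..a. q b)" if "a \<le> N" for a
    using that
  proof (induction a)
    case 0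
    then show ?case by (simp add: L0)
  next
    case (Suc a)
    define y where "y = fps_const (x (Suc a)) * fps_X"
    define Q where "Q = (\<Prod>b=1..a. q b)"
    have IH: "1 + W - L a = L a * W * Q"
      using Suc by (simp add: Q_def)
    have st: "L (Suc a) - y * L (Suc a) * (1 + W - L a) = L a"
      using step[OF Suc.prems] by (simp add: y_def algebra_simps)
    \<comment> \<open>Splitting \<open>1 + W\<close> as \<open>(1 + W - L a) + L a\<close> lets
      \<open>st\<close> absorb the first part, after which \<open>IH\<close> applies to both
      remaining terms.\<close>
    have "L (Suc a) * W * (Q * (1 - y * (1 + W)))
        = (L (Suc a) - y * L (Suc a) * (1 + W - L a)) * W * Q - y * L (Suc a) * (L a * W * Q)"
      by (simp add: algebra_simps)
    also have "\<dots> = L a * W * Q - y * L (Suc a) * (L a * W * Q)"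
      unfolding st ..
    also have "\<dots> = (1 + W - L a) - y * L (Suc a) * (1 + W - L a)"
      unfolding IH ..
    also have "\<dots> = 1 + W - L (Suc a)"
      using st by (simp add: algebra_simps)
    finally show ?case
      by (simp add: q_def y_def Q_def mult_ac)
  qed
  from this[of N] show ?thesis
    by (simp add: LN q_def)
qed

section \<open>Coefficient extraction by Lagrange inversion\<close>

lemma tree_fps_ascent_trees_nth:
  fixes N n :: nat and x :: "nat \<Rightarrow> rat"
  assumes "n \<ge> 1"
  shows "tree_fps {1..N} x ascent_trees $ n
    = (\<Sum>\<mu>\<in>partitions n. c_coeff n \<mu> / of_nat (z_part \<mu>) * (\<Prod>k\<in>#\<mu>. \<Sum>a=1..N. x a ^ k))"
proof -
  define W where "W = tree_fps {1..N} x ascent_trees"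
  define p where "p k = (\<Sum>a=1..N. x a ^ k)" for k
  define u where "u = fps_X * (1 + W)"
  define e where "e = fps_exp (1/2) oo power_sum_fps p"
  have u0: "u $ 0 = 0"
    by (simp add: u_def)
  have p0: "power_sum_fps p $ 0 = 0"
    by (simp add: power_sum_fps_def)
  have e_power: "e ^ m = fps_exp (of_nat m / 2) oo power_sum_fps p" for m
    unfolding e_def fps_compose_power[OF p0] fps_exp_power_mult by simp
  have "W ^ 2 = (e oo u) ^ 2"
  proof -
    define Q where "Q = (\<Prod>a=1..N. 1 - fps_const (x a) * u)"
    have "(fps_exp 1 oo power_sum_fps p) * (\<Prod>a=1..N. 1 - fps_const (x a) * fps_X) = 1"
      using exp_power_sum_fps_mult_prod[of "{1..N}" x] by (simp add: p_def[abs_def])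
    then have "(e ^ 2 * (\<Prod>a=1..N. 1 - fps_const (x a) * fps_X)) oo u = 1"
      unfolding e_power by simp
    then have eQ: "(e oo u) ^ 2 * Q = 1"
      by (simp add: Q_def fps_compose_mult_distrib[OF u0] fps_compose_prod_distrib[OF u0]
          fps_compose_sub_distrib fps_X_fps_compose_startby0[OF u0] fps_compose_power[OF u0])
    have WQ: "W ^ 2 * Q = 1"
      using ascent_trees_functional_equation[of N x]
      by (simp add: W_def Q_def u_def power2_eq_square)
    have "W ^ 2 = W ^ 2 * ((e oo u) ^ 2 * Q)"
      by (simp only: eQ mult_1_right)
    also have "\<dots> = (e oo u) ^ 2 * (W ^ 2 * Q)"
      by (simp only: mult_ac)
    finally show ?thesis
      by (simp only: WQ mult_1_right)
  qed
  \<comment> \<open>Both series have constant term 1, which excludes the negative square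
    root.\<close>
  moreover have "W + (e oo u) \<noteq> 0"
  proof -
    have "{T :: nat tree. T \<in> ascent_trees \<and> set_tree T \<subseteq> {1..N} \<and> size T = 0} = {\<langle>\<rangle>}"
      by (auto simp: Leaf_in_ascent_trees)
    then have "W $ 0 = 1"
      unfolding W_def tree_fps_nth by (simp only:) simp
    then have "(W + (e oo u)) $ 0 = 2"
      by (simp add: e_def)
    then show ?thesis
      by (metis fps_zero_nth zero_neq_numeral)
  qed
  ultimately have "W = e oo u"
    by (metis add_eq_0_iff power2_eq_iff)
  then have "u = fps_X * ((1 + e) oo u)"
    by (simp add: u_def fps_compose_add_distrib)
  \<comment> \<open>The index is \<open>Suc n\<close> because \<open>u = fps_X * (1 + W)\<close>
    shifts the coefficients of \<open>W\<close> by one.\<close>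
  then have "of_nat (Suc n) * u $ Suc n = ((1 + e) ^ Suc n) $ n"
    by (rule lagrange_inversion) (simp add: e_def)
  also have "(1 + e) ^ Suc n = (\<Sum>m\<le>Suc n. of_nat (Suc n choose m) * e ^ m)"
    by (subst add.commute, subst binomial_ring) simp
  also have "\<dots> $ n = (\<Sum>m\<le>Suc n. of_nat (Suc n choose m) *
      (\<Sum>\<mu>\<in>partitions n. (of_nat m / 2) ^ size \<mu> * (\<Prod>k\<in>#\<mu>. p k) / of_nat (z_part \<mu>)))"
    unfolding fps_sum_nth e_power cycle_index_fps_eq_exp[symmetric] fps_of_nat[symmetric]
      fps_mult_left_const_nth
    by (simp add: cycle_index_fps_def)
  also have "\<dots> = (\<Sum>\<mu>\<in>partitions n. (\<Sum>m\<le>Suc n. of_nat (Suc n choose m) * (of_nat m / 2) ^ size \<mu>)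
      * ((\<Prod>k\<in>#\<mu>. p k) / of_nat (z_part \<mu>)))"
    unfolding sum_distrib_left sum_distrib_right by (subst sum.swap) (simp add: mult.assoc)
  also have "\<dots> = (\<Sum>\<mu>\<in>partitions n. of_nat (Suc n) *
      (c_coeff n \<mu> / of_nat (z_part \<mu>) * (\<Prod>k\<in>#\<mu>. p k)))"
  proof (rule sum.cong)
    fix \<mu> assume "\<mu> \<in> partitions n"
    \<comment> \<open>As \<open>n \<ge> 1\<close>, the partition is nonempty; hence the term
      \<open>m = 0\<close> vanishes below and \<open>size \<mu> - 1\<close> is a true
      predecessor.\<close>
    then obtain s where s: "size \<mu> = Suc s"
      using assms by (cases "size \<mu>") (auto simp: partitions_def)
    have "(\<Sum>m\<le>Suc n. of_nat (Suc n choose m) * (of_nat m / 2) ^ size \<mu>)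
        = (\<Sum>m=1..Suc n. of_nat (Suc n choose m) * (of_nat m / 2 :: rat) ^ size \<mu>)"
      by (rule sum.mono_neutral_right) (auto simp: s)
    also have "\<dots> = (\<Sum>m=1..Suc n. of_nat (Suc n) *
        (1 / 2 ^ size \<mu> * (of_nat m ^ (size \<mu> - 1) * of_nat (n choose (m - 1)))))"
    proof (rule sum.cong)
      fix m assume "m \<in> {1..Suc n}"
      then obtain l where m: "m = Suc l" by (cases m) auto
      \<comment> \<open>Absorption uses up one power of \<open>m\<close> and yields the factor
        \<open>Suc n\<close> that cancels against the one from Lagrange inversion.\<close>
      have "(Suc n choose m) * m = Suc n * (n choose (m - 1))"
        unfolding m diff_Suc_1 using Suc_times_binomial[of l n] by (simp only: mult.commute)
      then have "of_nat (Suc n choose m) * of_nat m = (of_nat (Suc n) * of_nat (n choose (m - 1)) :: rat)"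
        by (simp only: of_nat_mult[symmetric])
      then have "of_nat (Suc n choose m) * of_nat m * of_nat m ^ s / 2 ^ Suc s
          = (of_nat (Suc n) * of_nat (n choose (m - 1)) * of_nat m ^ s / 2 ^ Suc s :: rat)"
        by (simp only:)
      then show "of_nat (Suc n choose m) * (of_nat m / 2 :: rat) ^ size \<mu>
          = of_nat (Suc n) * (1 / 2 ^ size \<mu> * (of_nat m ^ (size \<mu> - 1) * of_nat (n choose (m - 1))))"
        by (simp add: s power_divide mult_ac del: of_nat_Suc binomial_Suc_Suc)
    qed simp
    also have "\<dots> = of_nat (Suc n) * c_coeff n \<mu>"
      by (simp only: c_coeff_def sum_distrib_left Suc_eq_plus1)
    finally show "(\<Sum>m\<le>Suc n. of_nat (Suc n choose m) * (of_nat m / 2) ^ size \<mu>)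
        * ((\<Prod>k\<in>#\<mu>. p k) / of_nat (z_part \<mu>))
        = of_nat (Suc n) * (c_coeff n \<mu> / of_nat (z_part \<mu>) * (\<Prod>k\<in>#\<mu>. p k))"
      by (simp del: of_nat_Suc)
  qed simp
  finally have "u $ Suc n = (\<Sum>\<mu>\<in>partitions n. c_coeff n \<mu> / of_nat (z_part \<mu>) * (\<Prod>k\<in>#\<mu>. p k))"
    unfolding sum_distrib_left[symmetric] by (simp del: of_nat_Suc)
  moreover have "u $ Suc n = W $ n"
    using assms by (simp add: u_def)
  ultimately show ?thesis
    by (simp add: W_def p_def)
qed

text \<open>Both sides are homogeneous of degree \<open>n\<close>, so each evaluation is a multiple
  of \<open>fps_X ^ n\<close>, and the scalars agree by the preceding lemma.\<close>

theorem theorem5p10: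
  fixes n :: nat
  assumes "n \<ge> 1"
  shows "(tree_gf n 1 0 1 0 :: (nat, rat) mps) =
    (\<Sum>\<mu>\<in>partitions n. mps_const (c_coeff n \<mu> / of_nat (z_part \<mu>)) * power_sum_part \<mu>)"
proof (rule mps_eqI_eval)
  fix N and x :: "nat \<Rightarrow> rat"
  let ?p = "\<lambda>k. \<Sum>a=1..N. x a ^ k"
  let ?c = "\<lambda>\<mu>. c_coeff n \<mu> / of_nat (z_part \<mu>)"
  have "mps_eval {..N} x (\<Sum>\<mu>\<in>partitions n. mps_const (?c \<mu>) * power_sum_part \<mu>)
      = (\<Sum>\<mu>\<in>partitions n. fps_const (?c \<mu> * (\<Prod>k\<in>#\<mu>. ?p k)) * fps_X ^ n)"
    unfolding mps_eval_sum
  proof (rule sum.cong)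
    fix \<mu> assume "\<mu> \<in> partitions n"
    then have "mps_eval {..N} x (power_sum_part \<mu>) = fps_const (\<Prod>k\<in>#\<mu>. ?p k) * fps_X ^ n"
      using mps_eval_power_sum_part[of \<mu> N x] by (simp add: partitions_def)
    then show "mps_eval {..N} x (mps_const (?c \<mu>) * power_sum_part \<mu>)
        = fps_const (?c \<mu> * (\<Prod>k\<in>#\<mu>. ?p k)) * fps_X ^ n"
      by (simp add: mps_eval_mult mps_eval_const mult.assoc[symmetric])
  qed simp
  also have "\<dots> = fps_const (tree_fps {1..N} x ascent_trees $ n) * fps_X ^ n"
    unfolding tree_fps_ascent_trees_nth[OF assms]
    by (rule fps_ext) (simp add: fps_sum_nth)
  finally show "mps_eval {..N} x (tree_gf n 1 0 1 0)
      = mps_eval {..N} x (\<Sum>\<mu>\<in>partitions n. mps_const (?c \<mu>) * power_sum_part \<mu>)"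
    by (simp only: mps_eval_tree_gf)
qed

end
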